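(* For all $x,y\ge0$, $K_2^{\mathrm{ad}}(x,y)\le K_2(x,y)$. The inequality is strict exactly when $0<\min(x,y)<1<\max(x,y)$.
   Context: $K_2(x,y)=\mathbb P\{xD_1+yD_2\le 1\}$ where $(D_0,D_1,D_2)\sim\mathrm{Dirichlet}(1,1,1)$. Explicitly, with $a=\min(x,y)$ and $b=\max(x,y)$: $K_2=1$ if $b\le 1$; $K_2=1-\frac{(b-1)^2}{b(b-a)}$ if $0\le a<1<b$; $K_2=\frac1{ab}$ if $1\le a$. The function $K_2^{\mathrm{ad}}:[0,\infty)^2\to[0,1]$ is symmetric and is defined, with $a$ the minimum and $b$ the maximum of the two arguments, by $$K_2^{\mathrm{ad}}(a,b)=\begin{cases}1,& b\le 1,\\ \dfrac{2}{\tau(a,b)}-\dfrac1{\tau(a,b)^2},& 0\le a<1<b,\\ \dfrac1{ab},& 1\le a,\end{cases}$$ where for $0\le a<1<b$, $\tau(a,b)=\tfrac12\bigl(b(1+a)+\sqrt{b^2(1+a)^2-4ab}\bigr)$ is the larger root of $t^2-b(1+a)t+ab=0$. *)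

theory Defs
  imports "HOL-Probability.Probability"
begin

text \<open>
  The Dirichlet law with parameters \<open>\<alpha>\<^sub>0, \<alpha>\<^sub>1, \<alpha>\<^sub>2 > 0\<close> on the simplex of triples
  \<open>(d\<^sub>0, d\<^sub>1, d\<^sub>2)\<close> with sum 1. As usual, the density is taken with respect to Lebesgue
  measure in the coordinates \<open>(d\<^sub>1, d\<^sub>2)\<close>, with \<open>d\<^sub>0 = 1 - d\<^sub>1 - d\<^sub>2\<close>. The density is
  supported on the open simplex because \<open>0 powr 0 = 0\<close>; the boundary is a null set.
\<close>

definition dirichlet3_density :: "real \<Rightarrow> real \<Rightarrow> real \<Rightarrow> real \<times> real \<Rightarrow> real" where
  "dirichlet3_density \<alpha>\<^sub>0 \<alpha>\<^sub>1 \<alpha>\<^sub>2 = (\<lambda>(d\<^sub>1, d\<^sub>2).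
     if 0 < d\<^sub>1 \<and> 0 < d\<^sub>2 \<and> d\<^sub>1 + d\<^sub>2 < 1
     then Gamma (\<alpha>\<^sub>0 + \<alpha>\<^sub>1 + \<alpha>\<^sub>2) / (Gamma \<alpha>\<^sub>0 * Gamma \<alpha>\<^sub>1 * Gamma \<alpha>\<^sub>2)
          * (1 - d\<^sub>1 - d\<^sub>2) powr (\<alpha>\<^sub>0 - 1) * d\<^sub>1 powr (\<alpha>\<^sub>1 - 1) * d\<^sub>2 powr (\<alpha>\<^sub>2 - 1)
     else 0)"

definition dirichlet3 :: "real \<Rightarrow> real \<Rightarrow> real \<Rightarrow> (real \<times> real \<times> real) measure" where
  "dirichlet3 \<alpha>\<^sub>0 \<alpha>\<^sub>1 \<alpha>\<^sub>2 =
     distr (density lborel (\<lambda>p. ennreal (dirichlet3_density \<alpha>\<^sub>0 \<alpha>\<^sub>1 \<alpha>\<^sub>2 p))) borel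
       (\<lambda>(d\<^sub>1, d\<^sub>2). (1 - d\<^sub>1 - d\<^sub>2, d\<^sub>1, d\<^sub>2))"

definition K2 :: "real \<Rightarrow> real \<Rightarrow> real" where
  "K2 x y = measure (dirichlet3 1 1 1) {(d\<^sub>0, d\<^sub>1, d\<^sub>2). x * d\<^sub>1 + y * d\<^sub>2 \<le> 1}"

text \<open>For \<open>0 \<le> a < 1 < b\<close>, the larger root of \<open>t\<^sup>2 - b (1 + a) t + a b = 0\<close>.\<close>

definition tau :: "real \<Rightarrow> real \<Rightarrow> real" where
  "tau a b = (b * (1 + a) + sqrt (b\<^sup>2 * (1 + a)\<^sup>2 - 4 * a * b)) / 2"

text \<open>Only the values at \<open>x, y \<ge> 0\<close> are meaningful.\<close>

definition K2ad :: "real \<Rightarrow> real \<Rightarrow> real" where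
  "K2ad x y =
     (let a = min x y; b = max x y in
      if b \<le> 1 then 1
      else if a < 1 then 2 / tau a b - 1 / (tau a b)\<^sup>2
      else 1 / (a * b))"

end

theory Submission imports Defs begin

text \<open>
  The density of \<open>Dirichlet(1,1,1)\<close> is the constant 2 on the open triangle
  \<open>d\<^sub>1, d\<^sub>2 > 0\<close>, \<open>d\<^sub>1 + d\<^sub>2 < 1\<close>, so \<open>K2 x y\<close> is twice the area of the part of that triangle
  below the line \<open>x d\<^sub>1 + y d\<^sub>2 = 1\<close>. With \<open>a = min x y\<close> and \<open>b = max x y\<close>, that part is the
  whole triangle if \<open>b \<le> 1\<close>; it is the triangle with legs \<open>1/a\<close> and \<open>1/b\<close> if \<open>a \<ge> 1\<close>; and
  for \<open>a < 1 < b\<close> the line cuts off a triangle at the vertex \<open>d\<^sub>b = 1\<close>, where \<open>d\<^sub>b\<close> is the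
  coordinate with coefficient \<open>b\<close>. Each area comes from
  \<open>emeasure_linear_slices\<close>. In the first two cases twice the area is the value that defines \<open>K2ad\<close>.

  In the third case \<open>K2\<close> falls short of 1 by \<open>w\<^sup>2 = (b - 1)\<^sup>2 / (b (b - a))\<close>, and \<open>K2ad\<close> by
  \<open>v\<^sup>2\<close> with \<open>v = 1 - 1 / tau a b\<close>. The equation of \<open>tau\<close> says that \<open>v\<close> is the nonnegative
  root of \<open>a b v\<^sup>2 + b (1 - a) v = b - 1\<close>. The left-hand side increases in \<open>v \<ge> 0\<close>, so
  \<open>w \<le> v\<close> amounts to that expression being at most \<open>b - 1\<close> at \<open>w\<close>; this
  reduces to \<open>b - a \<le> sqrt (b (b - a))\<close>, an inequality that is strict exactly for \<open>a > 0\<close>.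
\<close>

section \<open>Twice the area of a truncated triangle\<close>

definition truncated_triangle :: "real \<Rightarrow> real \<Rightarrow> (real \<times> real) set" where
  "truncated_triangle x y = {(s, t). 0 < s \<and> 0 < t \<and> s + t < 1 \<and> x * s + y * t \<le> 1}"

lemma sets_borel_prod:
  "sets (borel \<Otimes>\<^sub>M borel)
    = sets (borel :: ('a::second_countable_topology \<times> 'b::second_countable_topology) measure)"
  by (subst borel_prod) (rule refl)

lemma truncated_triangle_borel [measurable]: "truncated_triangle x y \<in> sets borel"
proof -
  have "{p \<in> space (borel \<Otimes>\<^sub>M borel). 0 < fst p \<and> 0 < snd p \<and> fst p + snd p < 1 \<and>
      x * fst p + y * snd p \<le> 1} \<in> sets (borel \<Otimes>\<^sub>M borel)"
    by measurable
  then show ?thesis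
    by (simp add: truncated_triangle_def case_prod_unfold sets_borel_prod space_pair_measure)
qed

text \<open>
  The sample space of \<open>dirichlet3\<close> consists of triples; the first coordinate is determined by
  the others, so the event pulls back to a planar set.
\<close>

lemma K2_eq_area: "K2 x y = 2 * measure lborel (truncated_triangle x y)"
proof -
  let ?g = "\<lambda>(s, t). (1 - s - t, s, t) :: real \<times> real \<times> real"
  let ?S = "{(d\<^sub>0 :: real, s, t). x * s + y * t \<le> 1}"
  let ?d = "dirichlet3_density 1 1 1"
  have Gamma3: "Gamma (3 :: real) = 2"
    using Gamma_fact[of 2, where 'a = real] by simp
  have d: "?d p = 2 * indicator {(s, t). 0 < s \<and> 0 < t \<and> s + t < 1} p" for p
    by (cases p) (auto simp: dirichlet3_density_def Gamma3)
  have S: "?S \<in> sets borel"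
  proof -
    have "closed {p :: real \<times> real \<times> real. x * fst (snd p) + y * snd (snd p) \<le> 1}"
      by (intro closed_Collect_le continuous_intros)
    then show ?thesis by (simp add: case_prod_unfold borel_closed)
  qed
  have g: "?g \<in> borel \<rightarrow>\<^sub>M borel"
    by (intro borel_measurable_continuous_onI) (auto intro!: continuous_intros simp: case_prod_unfold)
  have D [measurable]: "{(s :: real, t :: real). 0 < s \<and> 0 < t \<and> s + t < 1} \<in> sets borel"
    using truncated_triangle_borel[of 0 0] by (simp add: truncated_triangle_def)
  have dm: "(\<lambda>p. ennreal (?d p)) \<in> borel_measurable lborel"
    unfolding d by measurable
  have pre: "?g -` ?S \<in> sets borel"
    using measurable_sets[OF g S] by simp
  have "emeasure (dirichlet3 1 1 1) ?S
      = emeasure (density lborel (\<lambda>p. ennreal (?d p))) (?g -` ?S)"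
    unfolding dirichlet3_def using g S by (subst emeasure_distr) auto
  also have "\<dots> = (\<integral>\<^sup>+ p. ennreal (?d p) * indicator (?g -` ?S) p \<partial>lborel)"
    using dm pre by (intro emeasure_density) auto
  also have "\<dots> = (\<integral>\<^sup>+ p. 2 * indicator (truncated_triangle x y) p \<partial>lborel)"
    by (intro nn_integral_cong) (auto simp: d truncated_triangle_def split: split_indicator)
  also have "\<dots> = 2 * emeasure lborel (truncated_triangle x y)"
    by (subst nn_integral_cmult_indicator) auto
  finally show ?thesis
    unfolding K2_def measure_def by (simp add: enn2real_mult)
qed

lemma truncated_triangle_commute:
  "measure lborel (truncated_triangle x y) = measure lborel (truncated_triangle y x)"
proof -
  have "emeasure (lborel \<Otimes>\<^sub>M lborel) (truncated_triangle x y)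
      = emeasure (distr (lborel \<Otimes>\<^sub>M lborel) (lborel \<Otimes>\<^sub>M lborel) (\<lambda>(s, t). (t, s)))
          (truncated_triangle x y)"
    by (subst lborel_pair.distr_pair_swap) simp
  also have "\<dots> = emeasure (lborel \<Otimes>\<^sub>M lborel)
      ((\<lambda>(s, t). (t, s)) -` truncated_triangle x y \<inter> space (lborel \<Otimes>\<^sub>M lborel))"
    by (intro emeasure_distr measurable_pair_swap') (simp add: sets_borel_prod)
  also have "(\<lambda>(s, t). (t, s)) -` truncated_triangle x y \<inter> space (lborel \<Otimes>\<^sub>M lborel)
      = truncated_triangle y x"
    by (auto simp: truncated_triangle_def space_pair_measure algebra_simps)
  finally show ?thesis
    by (simp add: lborel_prod measure_def)
qed

lemma K2_commute: "K2 x y = K2 y x"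
  by (simp add: K2_eq_area truncated_triangle_commute)

text \<open>
  The area of a triangle with base \<open>h\<close> on the vertical axis and height \<open>h / k\<close>, by Cavalieri's
  principle. Beyond the apex \<open>h - k s\<close> is negative and \<open>ennreal\<close> truncates it to 0, which is
  then the length of the empty slice.
\<close>

lemma emeasure_linear_slices:
  fixes A :: "(real \<times> real) set"
  assumes A: "A \<in> sets borel" and h: "0 \<le> h" and k: "0 < k"
    and pos: "\<And>s. 0 < s \<Longrightarrow> emeasure lborel {t. (s, t) \<in> A} = ennreal (h - k * s)"
    and neg: "\<And>s t. (s, t) \<in> A \<Longrightarrow> 0 < s"
  shows "emeasure lborel A = ennreal (h\<^sup>2 / (2 * k))"
proof -
  have "emeasure lborel A = (\<integral>\<^sup>+ s. emeasure lborel (Pair s -` A) \<partial>lborel)"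
    using lborel.emeasure_pair_measure_alt[of A lborel] A by (simp add: lborel_prod sets_borel_prod)
  also have "\<dots> = (\<integral>\<^sup>+ s. ennreal (h - k * s) * indicator {0..h / k} s \<partial>lborel)"
  proof (rule nn_integral_cong_AE)
    show "AE s in lborel. emeasure lborel (Pair s -` A)
        = ennreal (h - k * s) * indicator {0..h / k} s"
      using AE_lborel_singleton[of 0]
    proof eventually_elim
      case (elim s)
      show ?case
      proof (cases "0 < s")
        case True
        then have "emeasure lborel (Pair s -` A) = ennreal (h - k * s)"
          using pos[of s] by (simp add: vimage_def)
        moreover have "h - k * s \<le> 0" if "h / k < s"
          using that k by (simp add: field_simps)
        ultimately show ?thesis
          using True by (auto split: split_indicator simp: ennreal_neg)
      next
        case False
        then have "Pair s -` A = {}"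
          using neg by fastforce
        then show ?thesis
          using False elim by (auto split: split_indicator)
      qed
    qed
  qed
  also have "\<dots> = ennreal ((h * (h / k) - k * (h / k)\<^sup>2 / 2) - (h * 0 - k * 0\<^sup>2 / 2))"
  proof (rule nn_integral_FTC_Icc)
    show "((\<lambda>s. h * s - k * s\<^sup>2 / 2) has_real_derivative h - k * s) (at s)" for s
      by (auto intro!: derivative_eq_intros)
    show "0 \<le> h - k * s" if "s \<in> {0..h / k}" for s
      using that k by (simp add: field_simps)
  qed (use h k in auto)
  also have "(h * (h / k) - k * (h / k)\<^sup>2 / 2) - (h * 0 - k * 0\<^sup>2 / 2) = h\<^sup>2 / (2 * k)"
    using k by (simp add: field_simps power2_eq_square)
  finally show ?thesis .
qed

lemma emeasure_lborel_Ioo_real: "emeasure lborel {l<..<u} = ennreal (u - l)" for l u :: real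
  by (cases "l \<le> u") (auto simp: ennreal_neg)

lemma emeasure_lborel_Ioc_real: "emeasure lborel {l<..u} = ennreal (u - l)" for l u :: real
  by (cases "l \<le> u") (auto simp: ennreal_neg)

lemma area_full_triangle:
  assumes "x \<le> 1" "y \<le> 1"
  shows "emeasure lborel (truncated_triangle x y) = ennreal (1 / 2)"
proof -
  have below: "x * s + y * t \<le> 1" if "0 < s" "0 < t" "s + t < 1" for s t
    using that mult_right_mono[OF assms(1), of s] mult_right_mono[OF assms(2), of t] by linarith
  have "{t. (s, t) \<in> truncated_triangle x y} = {0<..<1 - s}" if "0 < s" for s
    using that below[of s] by (auto simp: truncated_triangle_def)
  then have "emeasure lborel (truncated_triangle x y) = ennreal (1\<^sup>2 / (2 * 1))"
    by (intro emeasure_linear_slices)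
       (auto simp: emeasure_lborel_Ioo_real, auto simp: truncated_triangle_def)
  then show ?thesis by simp
qed

section \<open>Closed form of the kernel\<close>

lemma K2_le_1:
  assumes "x \<le> 1" "y \<le> 1"
  shows "K2 x y = 1"
  unfolding K2_eq_area measure_def area_full_triangle[OF assms]
  by (simp only: enn2real_ennreal)

text \<open>
  For \<open>a \<ge> 1\<close> and \<open>b > 1\<close> the region below the line already lies inside the simplex, so the
  bound \<open>s + t < 1\<close> is automatic except at a boundary point, excluded by \<open>s, t > 0\<close>.
\<close>

lemma K2_ge_1:
  assumes "1 \<le> a" "1 < b"
  shows "K2 a b = 1 / (a * b)"
proof -
  have inside: "s + t < 1" if "0 < s" "0 < t" "a * s + b * t \<le> 1" for s t
    using that mult_right_mono[OF assms(1), of s] mult_strict_right_mono[OF assms(2), of t]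
    by linarith
  have "{t. (s, t) \<in> truncated_triangle a b} = {0<..1 / b - a / b * s}" if "0 < s" for s
    using that inside[of s] assms by (auto simp: truncated_triangle_def field_simps)
  then have "emeasure lborel (truncated_triangle a b) = ennreal ((1 / b)\<^sup>2 / (2 * (a / b)))"
    using assms
    by (intro emeasure_linear_slices)
       (auto simp: emeasure_lborel_Ioc_real, auto simp: truncated_triangle_def)
  then show ?thesis
    using assms by (simp add: K2_eq_area measure_def power2_eq_square)
qed

text \<open>
  The slices of the region itself are only piecewise linear. Those of the removed corner are
  linear, hence the passage to the complement in the full triangle.
\<close>

lemma K2_mixed:
  assumes "a < 1" "1 < b"
  shows "K2 a b = 1 - (b - 1)\<^sup>2 / (b * (b - a))"
proof -
  let ?T = "truncated_triangle 0 0" and ?C = "truncated_triangle 0 0 - truncated_triangle a b"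
  define c where "c = (b - 1)\<^sup>2 / (b * (b - a))"
  have slice: "{t. (s, t) \<in> ?C} = {(1 - a * s) / b<..<1 - s}" if "0 < s" for s
  proof -
    have "0 < t" if "(1 - a * s) / b < t" "t < 1 - s" for t
    proof -
      have "a * s < s" using assms \<open>0 < s\<close> by simp
      show ?thesis
      proof (rule ccontr)
        assume "\<not> 0 < t"
        then have "b * t \<le> 0" using assms by (simp add: mult_nonneg_nonpos)
        moreover have "1 < a * s + b * t"
          using that assms by (simp add: field_simps)
        moreover have "a * s + b * t \<le> a * s + t"
          using mult_right_mono_neg[of 1 b t] assms \<open>\<not> 0 < t\<close> by simp
        ultimately show False using \<open>a * s < s\<close> that by linarith
      qed
    qed
    then show ?thesis
      using that assms by (auto simp: truncated_triangle_def field_simps)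
  qed
  have "1 - s - (1 - a * s) / b = (b - 1) / b - (b - a) / b * s" for s
    using assms by (simp add: field_simps)
  then have "emeasure lborel ?C = ennreal (((b - 1) / b)\<^sup>2 / (2 * ((b - a) / b)))"
    using assms slice
    by (intro emeasure_linear_slices)
       (auto simp: emeasure_lborel_Ioo_real, auto simp: truncated_triangle_def)
  also have "((b - 1) / b)\<^sup>2 / (2 * ((b - a) / b)) = c / 2"
    using assms by (simp add: c_def field_simps power2_eq_square)
  finally have C: "measure lborel ?C = c / 2"
    using assms by (simp add: c_def measure_def)
  have T: "emeasure lborel ?T = ennreal (1 / 2)"
    by (rule area_full_triangle) auto
  then have mT: "measure lborel ?T = 1 / 2"
    by (simp only: measure_def enn2real_ennreal)
  have sub: "truncated_triangle a b \<subseteq> ?T"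
    by (auto simp: truncated_triangle_def)
  have "measure lborel ?C = measure lborel ?T - measure lborel (truncated_triangle a b)"
    using T sub by (intro measure_Diff) auto
  then have "2 * measure lborel (truncated_triangle a b) = 1 - c"
    unfolding C mT by linarith
  then show ?thesis
    by (simp only: K2_eq_area c_def)
qed

section \<open>Comparison in the mixed regime\<close>

text \<open>
  The substitution \<open>v = 1 - 1/\<tau>\<close> in the equation of \<open>tau\<close>. The bound \<open>tau a b \<ge> b\<close> comes from
  writing the discriminant as \<open>b\<^sup>2 (1 - a)\<^sup>2 + 4 a b (b - 1)\<close>.
\<close>

lemma tau_equation:
  assumes "0 \<le> a" "a < 1" "1 < b"
  defines "v \<equiv> 1 - 1 / tau a b"
  shows "b \<le> tau a b" and "a * b * v\<^sup>2 + b * (1 - a) * v = b - 1"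
proof -
  let ?D = "b\<^sup>2 * (1 + a)\<^sup>2 - 4 * a * b" and ?t = "tau a b"
  have D: "?D = (b * (1 - a))\<^sup>2 + 4 * a * b * (b - 1)"
    by (simp add: power2_eq_square algebra_simps)
  then have D_ge: "(b * (1 - a))\<^sup>2 \<le> ?D"
    using assms by simp
  then have D_nonneg: "0 \<le> ?D"
    by (rule order_trans[rotated]) simp
  have "b * (1 - a) \<le> sqrt ?D"
    by (rule real_le_rsqrt) (rule D_ge)
  then show t: "b \<le> ?t"
    by (simp add: tau_def algebra_simps)
  have "2 * ?t - b * (1 + a) = sqrt ?D"
    by (simp add: tau_def field_simps)
  then have "(2 * ?t - b * (1 + a))\<^sup>2 = ?D"
    using D_nonneg by simp
  then have root: "?t\<^sup>2 - b * (1 + a) * ?t + a * b = 0"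
    by (simp add: power2_eq_square algebra_simps)
  have "?t \<noteq> 0" using t assms by simp
  then have "(a * b * v\<^sup>2 + b * (1 - a) * v - (b - 1)) * ?t\<^sup>2 = ?t\<^sup>2 - b * (1 + a) * ?t + a * b"
    by (simp add: v_def field_simps power2_eq_square)
  then show "a * b * v\<^sup>2 + b * (1 - a) * v = b - 1"
    using root \<open>?t \<noteq> 0\<close> by simp
qed

text \<open>
  Both sides are 1 minus a square, so the claim is \<open>w < v\<close>. It is tested in the quadratic
  equation of \<open>v\<close>, which avoids the square root in \<open>tau\<close>.
\<close>

lemma K2ad_less_K2_mixed:
  assumes "0 < a" "a < 1" "1 < b"
  shows "2 / tau a b - 1 / (tau a b)\<^sup>2 < 1 - (b - 1)\<^sup>2 / (b * (b - a))"
proof -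
  define v where "v = 1 - 1 / tau a b"
  define m where "m = sqrt (b * (b - a))"
  define w where "w = (b - 1) / m"
  have t: "b \<le> tau a b" and v_eq: "a * b * v\<^sup>2 + b * (1 - a) * v = b - 1"
    using tau_equation[of a b] assms by (auto simp: v_def)
  have v_nonneg: "0 \<le> v"
    using t assms by (simp add: v_def)
  have m2: "m\<^sup>2 = b * (b - a)"
    using assms by (simp add: m_def)
  have "(b - a)\<^sup>2 < b * (b - a)"
    using assms by (simp add: power2_eq_square)
  then have m: "b - a < m"
    unfolding m_def by (rule real_less_rsqrt)
  have m_pos: "0 < m" and w_nonneg: "0 \<le> w"
    using m assms by (auto simp: w_def)
  have w2: "w\<^sup>2 = (b - 1)\<^sup>2 / (b * (b - a))"
    by (simp add: w_def power_divide m2)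
  \<comment> \<open>Divided by \<open>b - 1\<close>, the left-hand side is \<open>a (b - 1) / (b - a) + b (1 - a) / m\<close>; with
    \<open>b - a\<close> in place of the larger \<open>m\<close> the two terms would add up to exactly 1.\<close>
  have w_below: "a * b * w\<^sup>2 + b * (1 - a) * w < b - 1"
  proof -
    have "a * b * w\<^sup>2 = (b - 1) * (a * (b - 1) / (b - a))"
      using assms unfolding w2 by (simp add: power2_eq_square)
    moreover have "b * (1 - a) * w = (b - 1) * (b * (1 - a) / m)"
      by (simp add: w_def)
    moreover have "b * (1 - a) / m < b * (1 - a) / (b - a)"
      using m assms by (intro divide_strict_left_mono) auto
    moreover have "a * (b - 1) / (b - a) + b * (1 - a) / (b - a) = 1"
      using assms by (simp add: add_divide_distrib[symmetric] algebra_simps)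
    ultimately have "a * b * w\<^sup>2 + b * (1 - a) * w
        = (b - 1) * (a * (b - 1) / (b - a) + b * (1 - a) / m)"
      and "a * (b - 1) / (b - a) + b * (1 - a) / m < 1"
      by (simp_all add: distrib_left)
    then show ?thesis
      using assms by simp
  qed
  have "w < v"
  proof (rule ccontr)
    assume "\<not> w < v"
    then have "v \<le> w" by simp
    then have "a * b * v\<^sup>2 + b * (1 - a) * v \<le> a * b * w\<^sup>2 + b * (1 - a) * w"
      using v_nonneg assms by (intro add_mono mult_left_mono power_mono) auto
    then show False using w_below v_eq by simp
  qed
  then have "w\<^sup>2 < v\<^sup>2"
    using w_nonneg by (intro power_strict_mono) auto
  moreover have "v\<^sup>2 = 1 - (2 / tau a b - 1 / (tau a b)\<^sup>2)"
    by (simp add: v_def power2_eq_square algebra_simps)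
  ultimately show ?thesis
    by (simp add: w2)
qed

lemma tau_0: "1 < b \<Longrightarrow> tau 0 b = b"
  by (simp add: tau_def)

lemma K2ad_commute: "K2ad x y = K2ad y x"
  by (simp add: K2ad_def min.commute max.commute)

lemma K2ad_vs_K2_ordered:
  assumes "0 \<le> a" "a \<le> b"
  shows "K2ad a b \<le> K2 a b \<and> (K2ad a b < K2 a b \<longleftrightarrow> 0 < a \<and> a < 1 \<and> 1 < b)"
proof -
  consider "b \<le> 1" | "1 < b" "1 \<le> a" | "1 < b" "a = 0" | "1 < b" "0 < a" "a < 1"
    using assms by linarith
  then show ?thesis
  proof cases
    case 1
    then show ?thesis using assms by (simp add: K2ad_def K2_le_1)
  next
    case 2
    then show ?thesis using assms by (simp add: K2ad_def K2_ge_1)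
  next
    case 3
    moreover from this have "2 / b - 1 / b\<^sup>2 = 1 - (b - 1)\<^sup>2 / (b * b)"
      by (simp add: field_simps power2_eq_square)
    ultimately show ?thesis by (simp add: K2ad_def K2_mixed tau_0)
  next
    case 4
    then show ?thesis
      using assms K2ad_less_K2_mixed[of a b] by (simp add: K2ad_def K2_mixed)
  qed
qed

theorem lemma3p5:
  fixes x y :: real
  assumes "0 \<le> x" and "0 \<le> y"
  shows "K2ad x y \<le> K2 x y \<and>
         (K2ad x y < K2 x y \<longleftrightarrow> 0 < min x y \<and> min x y < 1 \<and> 1 < max x y)"
proof (cases "x \<le> y")
  case True
  then show ?thesis using K2ad_vs_K2_ordered[of x y] assms by simp
next
  case False
  then show ?thesis
    using K2ad_vs_K2_ordered[of y x] assms K2_commute[of x y] K2ad_commute[of x y] by simp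
qed

end
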